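(* Let $d\ge 1$ and let $X, Y$ be compact subsets of $\mathbb{R}^d$. Let $u\in L^2(X\times Y)$. Then, for every $\varepsilon>0$, there exist a (sufficiently large) positive integer $r$ and neural networks $f_j:\mathbb{R}^d\to\mathbb{R}$ and $g_j:\mathbb{R}^d\to\mathbb{R}$, $j=1,\dots,r$, such that $$\Big\|u-\sum_{j=1}^r f_j g_j\Big\|_{L^2(X\times Y)}<\varepsilon,$$ where $f_j g_j$ denotes the function $(x,y)\mapsto f_j(x)\,g_j(y)$ on $X\times Y$.
   Context: $L^2(X\times Y)$ is the space of real-valued square-integrable functions on $X\times Y\subset\mathbb{R}^{d}\times\mathbb{R}^d$ with respect to Lebesgue measure. A neural network $\mathbb{R}^d\to\mathbb{R}$ means a feedforward multilayer perceptron with real weights and biases, at least one hidden layer, arbitrary finite widths, activation function $\tanh$ applied componentwise at the hidden layers, and an affine output layer; for example, a one-hidden-layer network is a function of the form $x\mapsto b+\sum_{k=1}^{n} c_k\tanh(w_k\cdot x+b_k)$ with $n\in\mathbb{N}$, $w_k\in\mathbb{R}^d$, $b,b_k,c_k\in\mathbb{R}$. The sizes of the networks $f_j,g_j$ may depend on $u$ and $\varepsilon$. *)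

theory Defs
  imports "HOL-Analysis.Analysis"
begin

text \<open>
  \<open>hidden_layer m h\<close>: the functions \<open>h 0, \<dots>, h (m - 1)\<close> are the outputs, as functions of the
  network input, of a hidden layer of width \<open>m\<close> of a \<open>tanh\<close> multilayer perceptron. The
  entries \<open>h k\<close> with \<open>k \<ge> m\<close> carry no meaning and are never used.
\<close>

inductive hidden_layer :: "nat \<Rightarrow> (nat \<Rightarrow> real ^ 'n \<Rightarrow> real) \<Rightarrow> bool" where
  first: "m \<ge> 1 \<Longrightarrow> hidden_layer m (\<lambda>k x. tanh (w k \<bullet> x + b k))"
| deeper: "hidden_layer n h \<Longrightarrow> m \<ge> 1 \<Longrightarrow>
    hidden_layer m (\<lambda>k x. tanh ((\<Sum>i<n. W k i * h i x) + b k))"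

definition neural_network :: "(real ^ 'n \<Rightarrow> real) \<Rightarrow> bool" where
  "neural_network f \<longleftrightarrow>
    (\<exists>n h c b. hidden_layer n h \<and> f = (\<lambda>x. b + (\<Sum>k<n. c k * h k x)))"

text \<open>
  Elements of \<open>L\<^sup>2(S)\<close> are represented by functions on the whole type, of which only the
  values on \<open>S\<close> matter; almost everywhere equal functions are not identified.
\<close>

definition L2_space :: "'a::euclidean_space set \<Rightarrow> ('a \<Rightarrow> real) set" where
  "L2_space S = {u. u \<in> borel_measurable (lebesgue_on S) \<and>
                    integrable (lebesgue_on S) (\<lambda>z. (u z)\<^sup>2)}"

text \<open>Only meaningful on \<open>L2_space S\<close>: the integral of a non-integrable function is \<open>0\<close>.\<close>

definition L2_norm :: "'a::euclidean_space set \<Rightarrow> ('a \<Rightarrow> real) \<Rightarrow> real" where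
  "L2_norm S u = sqrt (\<integral>z. (u z)\<^sup>2 \<partial>lebesgue_on S)"

end

theory Submission imports Defs begin

text \<open>
  Truncation and dominated convergence make continuous functions dense in
  \<open>L\<^sup>2(X \<times> Y)\<close>. By Stone--Weierstrass a continuous function on \<open>X \<times> Y\<close> is a uniform limit
  of linear combinations of products \<open>exp (w \<bullet> x) * exp (v \<bullet> y)\<close>, which form an algebra.
  Finally \<open>exp t\<close> is the limit, uniformly for bounded \<open>t\<close>, of
  \<open>exp (2 * s) / 2 * (1 + tanh (t / 2 - s))\<close> as \<open>s \<rightarrow> \<infinity>\<close>, so \<open>x \<mapsto> exp (w \<bullet> x)\<close> is a uniform
  limit on compact sets of networks with a single hidden neuron.
\<close>

section \<open>Approximation in \<open>L\<^sup>2\<close>\<close>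

lemma square_add_le: "(a + b)\<^sup>2 \<le> 2 * a\<^sup>2 + 2 * (b::real)\<^sup>2"
  using zero_le_power2[of "a - b"] by (simp add: power2_eq_square algebra_simps)

lemma L2_space_measurable: "f \<in> L2_space S \<Longrightarrow> f \<in> borel_measurable (lebesgue_on S)"
  and L2_space_integrable: "f \<in> L2_space S \<Longrightarrow> integrable (lebesgue_on S) (\<lambda>z. (f z)\<^sup>2)"
  by (auto simp: L2_space_def)

lemma L2_space_dominated:
  assumes "f \<in> borel_measurable (lebesgue_on S)" "integrable (lebesgue_on S) w"
    and "AE z in lebesgue_on S. (f z)\<^sup>2 \<le> w z"
  shows "f \<in> L2_space S"
proof -
  have "integrable (lebesgue_on S) (\<lambda>z. (f z)\<^sup>2)"
    using assms(2)
  proof (rule Bochner_Integration.integrable_bound)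
    show "(\<lambda>z. (f z)\<^sup>2) \<in> borel_measurable (lebesgue_on S)"
      using assms(1) by measurable
    show "AE z in lebesgue_on S. norm ((f z)\<^sup>2) \<le> norm (w z)"
      using assms(3) by eventually_elim auto
  qed
  then show ?thesis
    using assms(1) by (simp add: L2_space_def)
qed

lemma L2_space_add:
  assumes "f \<in> L2_space S" "g \<in> L2_space S"
  shows "(\<lambda>z. f z + g z) \<in> L2_space S"
proof (rule L2_space_dominated)
  show "(\<lambda>z. f z + g z) \<in> borel_measurable (lebesgue_on S)"
    using assms[THEN L2_space_measurable] by measurable
  show "integrable (lebesgue_on S) (\<lambda>z. 2 * (f z)\<^sup>2 + 2 * (g z)\<^sup>2)"
    using assms[THEN L2_space_integrable] by simp
qed (simp add: square_add_le)

lemma L2_norm_less_iff: "e > 0 \<Longrightarrow> L2_norm S f < e \<longleftrightarrow> (\<integral>z. (f z)\<^sup>2 \<partial>lebesgue_on S) < e\<^sup>2"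
  unfolding L2_norm_def by (metis real_sqrt_less_iff real_sqrt_unique less_imp_le)

text \<open>A substitute for the triangle inequality: the factors 2 lost in
  \<open>square_add_le\<close> are absorbed exactly by the halves, since 2 (e/2)^2 + 2 (e/2)^2 =
  e^2.\<close>

lemma L2_norm_add_less:
  assumes f: "f \<in> L2_space S" "L2_norm S f < e/2" and g: "g \<in> L2_space S" "L2_norm S g < e/2"
    and "e > 0"
  shows "L2_norm S (\<lambda>z. f z + g z) < e"
proof -
  have "(\<integral>z. (f z + g z)\<^sup>2 \<partial>lebesgue_on S) \<le> (\<integral>z. 2 * (f z)\<^sup>2 + 2 * (g z)\<^sup>2 \<partial>lebesgue_on S)"
    using L2_space_add[OF f(1) g(1)] f(1) g(1)
    by (intro integral_mono Bochner_Integration.integrable_add integrable_mult_right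
        L2_space_integrable square_add_le)
  also have "\<dots> = 2 * (\<integral>z. (f z)\<^sup>2 \<partial>lebesgue_on S) + 2 * (\<integral>z. (g z)\<^sup>2 \<partial>lebesgue_on S)"
    using f(1) g(1) by (simp add: L2_space_integrable)
  also have "\<dots> < 2 * (e/2)\<^sup>2 + 2 * (e/2)\<^sup>2"
    using f(2) g(2) L2_norm_less_iff[of "e/2" S f] L2_norm_less_iff[of "e/2" S g] \<open>e > 0\<close>
    by linarith
  finally show ?thesis
    using \<open>e > 0\<close> by (simp add: L2_norm_less_iff power_divide)
qed

text \<open>Scalar dominated convergence applies to the squares, which is why \<open>w\<close>
  bounds the square; continuity of the square root then gives the norms.\<close>

lemma L2_norm_dominated_convergence:
  assumes [measurable]: "\<And>n. s n \<in> borel_measurable (lebesgue_on S)"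
    and w: "integrable (lebesgue_on S) w"
    and "\<And>n. AE z in lebesgue_on S. (s n z)\<^sup>2 \<le> w z"
    and "AE z in lebesgue_on S. (\<lambda>n. s n z) \<longlonglongrightarrow> 0"
  shows "(\<lambda>n. L2_norm S (s n)) \<longlonglongrightarrow> 0"
proof -
  have "(\<lambda>n. \<integral>z. (s n z)\<^sup>2 \<partial>lebesgue_on S) \<longlonglongrightarrow> (\<integral>z. 0 \<partial>lebesgue_on S)"
  proof (rule integral_dominated_convergence[OF _ _ w])
    show "AE z in lebesgue_on S. (\<lambda>n. (s n z)\<^sup>2) \<longlonglongrightarrow> 0"
      using assms(4) by eventually_elim (auto dest: tendsto_power[where n = 2])
    show "AE z in lebesgue_on S. norm ((s n z)\<^sup>2) \<le> w z" for n
      using assms(3)[of n] by simp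
  qed measurable
  then show ?thesis
    unfolding L2_norm_def by (auto dest: tendsto_real_sqrt)
qed

section \<open>Continuous functions on compact sets\<close>

lemma integrable_const_lebesgue_on_compact:
  fixes S :: "'a::euclidean_space set"
  shows "compact S \<Longrightarrow> integrable (lebesgue_on S) (\<lambda>z. c::real)"
  by (simp add: finite_measure.integrable_const finite_measure_lebesgue_on lmeasurable_compact)

lemma continuous_in_L2_space:
  fixes S :: "'a::euclidean_space set"
  assumes "compact S" "continuous_on S f"
  shows "f \<in> L2_space S"
proof -
  obtain B where B: "\<forall>z\<in>S. norm (f z) \<le> B"
    using compact_imp_bounded[OF compact_continuous_image[OF assms(2,1)]]
    by (auto simp: bounded_iff)
  show ?thesis
  proof (rule L2_space_dominated)
    show "f \<in> borel_measurable (lebesgue_on S)"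
      using assms(1)
      by (intro continuous_imp_measurable_on_sets_lebesgue[OF assms(2)] fmeasurableD lmeasurable_compact)
    show "integrable (lebesgue_on S) (\<lambda>z. B\<^sup>2)"
      using assms(1) by (rule integrable_const_lebesgue_on_compact)
    show "AE z in lebesgue_on S. (f z)\<^sup>2 \<le> B\<^sup>2"
    proof (rule AE_I2)
      show "(f z)\<^sup>2 \<le> B\<^sup>2" if "z \<in> space (lebesgue_on S)" for z
        using B that power_mono[of "\<bar>f z\<bar>" B 2] by simp
    qed
  qed
qed

text \<open>A compact set has finite measure m, so a uniform bound \<open>d\<close> costs at most a
  factor sqrt m in the norm. The tolerance \<open>d\<close> is obtained before \<open>f\<close>,
  because the approximant is chosen only after the tolerance is known.\<close>

lemma L2_norm_less_of_uniform:
  fixes S :: "'a::euclidean_space set"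
  assumes "compact S" "e > 0"
  obtains d where "d > 0"
    "\<And>f. continuous_on S f \<Longrightarrow> (\<And>z. z \<in> S \<Longrightarrow> \<bar>f z\<bar> < d) \<Longrightarrow> L2_norm S f < e"
proof
  let ?m = "measure (lebesgue_on S) (space (lebesgue_on S))"
  \<comment> \<open>The \<open>+ 1\<close> keeps the divisor positive on null sets and makes the
    final estimate strict.\<close>
  define d where "d = e / sqrt (?m + 1)"
  show "d > 0"
    using \<open>e > 0\<close> by (simp add: d_def add_nonneg_pos)
  show "L2_norm S f < e" if f: "continuous_on S f" "\<And>z. z \<in> S \<Longrightarrow> \<bar>f z\<bar> < d" for f
  proof -
    have "(\<integral>z. (f z)\<^sup>2 \<partial>lebesgue_on S) \<le> (\<integral>z. d\<^sup>2 \<partial>lebesgue_on S)"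
    proof (rule integral_mono)
      show "integrable (lebesgue_on S) (\<lambda>z. (f z)\<^sup>2)"
        using assms(1) f(1) by (intro L2_space_integrable continuous_in_L2_space)
      show "integrable (lebesgue_on S) (\<lambda>z. d\<^sup>2)"
        using assms(1) by (rule integrable_const_lebesgue_on_compact)
      show "(f z)\<^sup>2 \<le> d\<^sup>2" if "z \<in> space (lebesgue_on S)" for z
        using f(2)[of z] that power_mono[of "\<bar>f z\<bar>" d 2] by simp
    qed
    also have "\<dots> = ?m * d\<^sup>2"
      by simp
    also have "\<dots> < (?m + 1) * d\<^sup>2"
      using \<open>d > 0\<close> by (intro mult_strict_right_mono) auto
    also have "\<dots> = e\<^sup>2"
      by (simp add: d_def power_divide add_nonneg_eq_0_iff)
    finally show ?thesis
      using \<open>e > 0\<close> by (simp add: L2_norm_less_iff)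
  qed
qed

section \<open>Truncation and density of continuous functions\<close>

definition clamp_at :: "real \<Rightarrow> real \<Rightarrow> real" where
  "clamp_at M t = max (- M) (min M t)"

lemma continuous_on_clamp_at [continuous_intros]:
  "continuous_on A f \<Longrightarrow> continuous_on A (\<lambda>x. clamp_at M (f x))"
  unfolding clamp_at_def by (intro continuous_intros)

lemma borel_measurable_clamp_at [measurable]: "clamp_at M \<in> borel_measurable borel"
  unfolding clamp_at_def by measurable

lemma abs_clamp_at_le: "M \<ge> 0 \<Longrightarrow> \<bar>clamp_at M t\<bar> \<le> M"
  unfolding clamp_at_def by auto

text \<open>Truncation moves \<open>t\<close> towards 0 without crossing it. Hence the square of
  \<open>u\<close> dominates all truncation errors of \<open>u\<close>.\<close>

lemma square_diff_clamp_at_le: "M \<ge> 0 \<Longrightarrow> (t - clamp_at M t)\<^sup>2 \<le> t\<^sup>2"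
  unfolding clamp_at_def abs_le_square_iff[symmetric] by auto

lemma clamp_at_eventually_id: "eventually (\<lambda>n. clamp_at (real n) t = t) sequentially"
  using eventually_ge_at_top[of "nat \<lceil>\<bar>t\<bar>\<rceil>"]
  by eventually_elim (auto simp: clamp_at_def max_def min_def nat_le_iff ceiling_le_iff)

text \<open>Two applications of dominated convergence, each costing \<open>e/2\<close>: first
  \<open>u\<close> is replaced by its truncation at a level \<open>m\<close>, then that by the
  truncations at the same level of continuous functions tending to \<open>u\<close> almost
  everywhere. Truncating the continuous functions as well supplies a constant dominating
  function.\<close>

lemma L2_continuous_approx:
  fixes S :: "'a::euclidean_space set"
  assumes "compact S" and u: "u \<in> L2_space S" and "e > 0"
  obtains v where "continuous_on UNIV v" "(\<lambda>z. u z - v z) \<in> L2_space S"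
    "L2_norm S (\<lambda>z. u z - v z) < e"
proof -
  let ?M = "lebesgue_on S"
  have S: "S \<in> sets lebesgue"
    using assms(1) by (simp add: fmeasurableD lmeasurable_compact)
  note [measurable] = L2_space_measurable[OF u]
  have "(\<lambda>n. L2_norm S (\<lambda>z. u z - clamp_at (real n) (u z))) \<longlonglongrightarrow> 0"
  proof (rule L2_norm_dominated_convergence[OF _ L2_space_integrable[OF u]])
    show "AE z in ?M. (\<lambda>n. u z - clamp_at (real n) (u z)) \<longlonglongrightarrow> 0"
    proof (rule AE_I2)
      show "(\<lambda>n. u z - clamp_at (real n) (u z)) \<longlonglongrightarrow> 0" for z
        using clamp_at_eventually_id[of "u z"]
        by (intro tendsto_eventually) (auto elim: eventually_mono)
    qed
  qed (auto simp: square_diff_clamp_at_le)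
  then have "eventually (\<lambda>n. L2_norm S (\<lambda>z. u z - clamp_at (real n) (u z)) < e/2) sequentially"
    using \<open>e > 0\<close> by (intro order_tendstoD) auto
  then obtain m where m: "L2_norm S (\<lambda>z. u z - clamp_at (real m) (u z)) < e/2"
    by (auto simp: eventually_sequentially)
  let ?T = "clamp_at (real m)"
  \<comment> \<open>Unfolding \<open>measurable_on\<close> turns Lebesgue measurability into almost
    everywhere convergence of continuous functions on the whole space to \<open>u\<close> extended
    by 0.\<close>
  obtain N g where N: "negligible N" and g: "\<And>n. continuous_on UNIV (g n)"
    and lim: "\<And>z. z \<notin> N \<Longrightarrow> (\<lambda>n. g n z) \<longlonglongrightarrow> (if z \<in> S then u z else 0)"
    using L2_space_measurable[OF u] measurable_on_iff_borel_measurable[OF S, of u]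
    unfolding measurable_on_def by blast
  have [measurable]: "g n \<in> borel_measurable ?M" for n
    using continuous_imp_measurable_on_sets_lebesgue[OF continuous_on_subset[OF g] S] by simp
  \<comment> \<open>Both values lie in [-m, m], so they differ by at most 2 m.\<close>
  have bound: "(?T a - ?T b)\<^sup>2 \<le> 4 * (real m)\<^sup>2" for a b
    using abs_clamp_at_le[of "real m" a] abs_clamp_at_le[of "real m" b]
      power_mono[of "\<bar>?T a - ?T b\<bar>" "2 * real m" 2] by simp
  have "(\<lambda>n. L2_norm S (\<lambda>z. ?T (u z) - ?T (g n z))) \<longlonglongrightarrow> 0"
  proof (rule L2_norm_dominated_convergence[where w = "\<lambda>z. 4 * (real m)\<^sup>2"])
    show "integrable ?M (\<lambda>z. 4 * (real m)\<^sup>2)"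
      using assms(1) by (rule integrable_const_lebesgue_on_compact)
    have "N \<in> null_sets lebesgue"
      using N by (simp add: negligible_iff_null_sets)
    then have "AE z in lebesgue. z \<notin> N"
      by (rule AE_not_in)
    then have "AE z in ?M. z \<notin> N"
      using S by (subst AE_restrict_space_iff) (auto elim: eventually_mono)
    \<comment> \<open>Only on \<open>S\<close> is the limit of \<open>g n z\<close> equal to
      \<open>u z\<close> rather than 0.\<close>
    moreover have "AE z in ?M. z \<in> S"
      using S by (simp add: AE_restrict_space_iff)
    ultimately show "AE z in ?M. (\<lambda>n. ?T (u z) - ?T (g n z)) \<longlonglongrightarrow> 0"
    proof eventually_elim
      fix z assume z: "z \<notin> N" "z \<in> S"
      have "(\<lambda>n. ?T (g n z)) \<longlonglongrightarrow> ?T (u z)"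
        unfolding clamp_at_def using lim[OF z(1)] z(2)
        by (intro tendsto_max tendsto_min tendsto_const) simp
      then show "(\<lambda>n. ?T (u z) - ?T (g n z)) \<longlonglongrightarrow> 0"
        using tendsto_diff[OF tendsto_const, of _ "?T (u z)" _ "?T (u z)"] by fastforce
    qed
  qed (auto simp: bound)
  then have "eventually (\<lambda>n. L2_norm S (\<lambda>z. ?T (u z) - ?T (g n z)) < e/2) sequentially"
    using \<open>e > 0\<close> by (intro order_tendstoD) auto
  then obtain n where n: "L2_norm S (\<lambda>z. ?T (u z) - ?T (g n z)) < e/2"
    by (auto simp: eventually_sequentially)
  \<comment> \<open>Small norms alone would not do: \<open>L2_norm\<close> also takes the value 0
    when the square is not integrable, so membership is established for each summand.\<close>
  have 1: "(\<lambda>z. u z - ?T (u z)) \<in> L2_space S"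
    by (rule L2_space_dominated[OF _ L2_space_integrable[OF u]]) (auto simp: square_diff_clamp_at_le)
  have 2: "(\<lambda>z. ?T (u z) - ?T (g n z)) \<in> L2_space S"
    by (rule L2_space_dominated[OF _ integrable_const_lebesgue_on_compact[OF assms(1),
            of "4 * (real m)\<^sup>2"]]) (auto simp: bound)
  show thesis
  proof
    show "continuous_on UNIV (\<lambda>z. ?T (g n z))"
      by (intro continuous_intros g)
    show "(\<lambda>z. u z - ?T (g n z)) \<in> L2_space S"
      using L2_space_add[OF 1 2] by simp
    show "L2_norm S (\<lambda>z. u z - ?T (g n z)) < e"
      using L2_norm_add_less[OF 1 m 2 n \<open>e > 0\<close>] by simp
  qed
qed

section \<open>Networks and exponentials\<close>

lemma neural_network_neuron: "neural_network (\<lambda>x. a + c * tanh (w \<bullet> x + b))"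
proof -
  have "hidden_layer 1 (\<lambda>k x. tanh (w \<bullet> x + b))"
    using hidden_layer.first[of 1 "\<lambda>_. w" "\<lambda>_. b"] by simp
  then show ?thesis
    unfolding neural_network_def
    by (intro exI[of _ 1] exI[of _ "\<lambda>k x. tanh (w \<bullet> x + b)"] exI[of _ "\<lambda>_. c"] exI[of _ a]) simp
qed

text \<open>This is exp (2 s) times the logistic sigmoid at t - 2 s. Far to the left the sigmoid
  behaves like the exponential, and the prefactor undoes the shift.\<close>

definition neural_exp :: "real \<Rightarrow> real \<Rightarrow> real" where
  "neural_exp s t = exp (2 * s) / 2 * (1 + tanh (t / 2 - s))"

lemma neural_exp_eq: "neural_exp s t = exp t / (1 + exp (t - 2 * s))"
proof -
  have *: "1 + tanh z = 2 * exp (2 * z) / (1 + exp (2 * z))" for z :: real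
  proof -
    have "1 + tanh z = 1 + (1 - inverse (exp (2 * z))) / (1 + inverse (exp (2 * z)))"
      by (simp add: tanh_real_altdef exp_minus)
    also have "\<dots> = 2 * exp (2 * z) / (1 + exp (2 * z))"
    proof -
      \<comment> \<open>With y for exp (2 z) the claim becomes a rational identity with nonzero
        denominators.\<close>
      have "1 + (1 - inverse y) / (1 + inverse y) = 2 * y / (1 + y)" if "y > 0" for y :: real
      proof -
        have "y + y\<^sup>2 \<noteq> 0" "1 + y \<noteq> 0" "1 + inverse y \<noteq> 0"
          using that by (auto simp: add_pos_pos add_pos_nonneg order.strict_implies_not_eq[symmetric])
        then show ?thesis
          using that by (simp add: field_simps power2_eq_square)
      qed
      then show ?thesis by simp
    qed
    finally show ?thesis .
  qed
  have "2 * (t / 2 - s) = t - 2 * s"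
    by simp
  moreover have "exp (2 * s) * exp (t - 2 * s) = exp t"
    by (simp flip: exp_add)
  ultimately show ?thesis
    unfolding neural_exp_def * by simp
qed

text \<open>The relative error is at most exp (t - 2 s). The resulting bound increases with
  \<open>t\<close>, so an upper bound on \<open>t\<close> makes it uniform.\<close>

lemma neural_exp_error: "\<bar>neural_exp s t - exp t\<bar> \<le> exp (2 * t - 2 * s)"
proof -
  have "exp t - neural_exp s t = exp t * exp (t - 2 * s) / (1 + exp (t - 2 * s))"
    unfolding neural_exp_eq by (simp add: field_simps add_pos_pos order.strict_implies_not_eq[symmetric])
  also have "exp t * exp (t - 2 * s) = exp (2 * t - 2 * s)"
    by (simp add: exp_add[symmetric])
  finally have "\<bar>neural_exp s t - exp t\<bar> = exp (2 * t - 2 * s) / (1 + exp (t - 2 * s))"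
    by (simp add: abs_minus_commute)
  also have "\<dots> \<le> exp (2 * t - 2 * s)"
    by (simp add: divide_le_eq add_pos_pos)
  finally show ?thesis .
qed

text \<open>The prefactor and \<open>c\<close> go into the output weight and bias, the factor 1/2
  into the hidden weight and -s into the hidden bias. The factor \<open>c\<close> will carry the
  coefficient of a monomial.\<close>

lemma neural_network_neural_exp: "neural_network (\<lambda>x. c * neural_exp s (w \<bullet> x))"
  using neural_network_neuron[of "c * exp (2 * s) / 2" "c * exp (2 * s) / 2" "(1/2) *\<^sub>R w" "- s"]
  unfolding neural_exp_def by (simp add: algebra_simps)

text \<open>By Cauchy-Schwarz the inner product is bounded above on \<open>X\<close>, so the error
  bound becomes a geometric sequence of ratio exp (-2), independent of \<open>x\<close>.\<close>

lemma uniform_limit_neural_exp: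
  assumes "bounded X"
  shows "uniform_limit X (\<lambda>n x. neural_exp (real n) (w \<bullet> x)) (\<lambda>x. exp (w \<bullet> x)) sequentially"
proof -
  obtain B where "\<forall>x\<in>X. norm x \<le> B"
    using assms unfolding bounded_iff by blast
  then have B: "w \<bullet> x \<le> norm w * B" if "x \<in> X" for x
    using that norm_cauchy_schwarz[of w x] mult_left_mono[of "norm x" B "norm w"] by force
  have "uniform_limit X (\<lambda>n x. neural_exp (real n) (w \<bullet> x) - exp (w \<bullet> x)) (\<lambda>x. 0) sequentially"
  proof (rule uniform_limit_null_comparison[where g = "\<lambda>n x. exp (2 * (norm w * B) - 2 * real n)"])
    show "\<forall>\<^sub>F n in sequentially. \<forall>x\<in>X. norm (neural_exp (real n) (w \<bullet> x) - exp (w \<bullet> x))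
        \<le> exp (2 * (norm w * B) - 2 * real n)"
    proof (intro always_eventually allI ballI)
      fix n x assume "x \<in> X"
      then have "exp (2 * (w \<bullet> x) - 2 * real n) \<le> exp (2 * (norm w * B) - 2 * real n)"
        using B by auto
      then show "norm (neural_exp (real n) (w \<bullet> x) - exp (w \<bullet> x))
          \<le> exp (2 * (norm w * B) - 2 * real n)"
        using neural_exp_error order_trans unfolding real_norm_def by blast
    qed
    have "(\<lambda>n. exp (2 * (norm w * B)) * exp (- 2) ^ n) \<longlonglongrightarrow> (0::real)"
      by (intro tendsto_mult_right_zero LIMSEQ_power_zero) simp
    moreover have "exp (2 * (norm w * B)) * exp (- 2) ^ n = exp (2 * (norm w * B) - 2 * real n)" for n
      by (simp add: exp_of_nat_mult[symmetric] mult_exp_exp)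
    ultimately have "(\<lambda>n. exp (2 * (norm w * B) - 2 * real n)) \<longlonglongrightarrow> 0"
      by simp
    then show "uniform_limit X (\<lambda>n x. exp (2 * (norm w * B) - 2 * real n)) (\<lambda>x. 0) sequentially"
      by (auto simp: uniform_limit_iff tendsto_iff elim: eventually_mono)
  qed
  then show ?thesis
    by (simp add: uniform_limit_iff dist_norm)
qed

section \<open>The algebra of exponential sums\<close>

text \<open>The coefficient sits in the monomial, so scalar multiples need no rule of their own;
  closure under products is derived from the addition of exponents.\<close>

inductive exp_poly :: "('a::real_inner \<times> 'a \<Rightarrow> real) \<Rightarrow> bool" where
  monomial: "exp_poly (\<lambda>p. c * (exp (w \<bullet> fst p) * exp (v \<bullet> snd p)))"
| add: "exp_poly f \<Longrightarrow> exp_poly g \<Longrightarrow> exp_poly (\<lambda>p. f p + g p)"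

lemma continuous_on_exp_poly: "exp_poly f \<Longrightarrow> continuous_on A f"
  by (induction rule: exp_poly.induct) (auto intro!: continuous_intros)

lemma exp_poly_mult_monomial:
  "exp_poly f \<Longrightarrow> exp_poly (\<lambda>p. f p * (c * (exp (w \<bullet> fst p) * exp (v \<bullet> snd p))))"
proof (induction rule: exp_poly.induct)
  case (monomial c' w' v')
  show ?case
    using exp_poly.monomial[of "c' * c" "w' + w" "v' + v"]
    by (simp add: inner_add_left exp_add mult_ac)
next
  case (add f g)
  then show ?case
    using exp_poly.add by (fastforce simp: distrib_right)
qed

text \<open>The right factor comes first among the premises so that the induction runs over it, with
  \<open>exp_poly_mult_monomial\<close> as base case.\<close>

lemma exp_poly_mult: "exp_poly g \<Longrightarrow> exp_poly f \<Longrightarrow> exp_poly (\<lambda>p. f p * g p)"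
proof (induction rule: exp_poly.induct)
  case (monomial c w v)
  then show ?case by (rule exp_poly_mult_monomial)
next
  case (add g h)
  then show ?case
    using exp_poly.add by (fastforce simp: distrib_left)
qed

lemma exp_poly_const: "exp_poly (\<lambda>p. c)"
  using exp_poly.monomial[of c 0 0] by simp

text \<open>In a component where the points differ, their difference serves as exponent vector: its
  inner products with the two components differ by its squared norm, and exp is injective.\<close>

lemma exp_poly_separates:
  fixes p q :: "'a::real_inner \<times> 'a"
  assumes "p \<noteq> q"
  shows "\<exists>f. exp_poly f \<and> f p \<noteq> f q"
proof (cases "fst p = fst q")
  case False
  define w where "w = fst p - fst q"
  have "w \<bullet> fst p \<noteq> w \<bullet> fst q"
    using False unfolding w_def
    by (metis inner_diff_right inner_eq_zero_iff right_minus_eq)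
  then show ?thesis
    using exp_poly.monomial[of 1 w 0] by (intro exI[of _ "\<lambda>p. exp (w \<bullet> fst p)"]) simp
next
  case True
  then have "snd p \<noteq> snd q"
    using assms by (simp add: prod_eq_iff)
  define v where "v = snd p - snd q"
  have "v \<bullet> snd p \<noteq> v \<bullet> snd q"
    using \<open>snd p \<noteq> snd q\<close> unfolding v_def
    by (metis inner_diff_right inner_eq_zero_iff right_minus_eq)
  then show ?thesis
    using exp_poly.monomial[of 1 0 v] by (intro exI[of _ "\<lambda>p. exp (v \<bullet> snd p)"]) simp
qed

section \<open>Sums of products of networks\<close>

text \<open>The shape matches the existential conclusion of the theorem, so that the witnesses can
  be read off from the final approximant.\<close>

definition network_product_sum :: "((real ^ 'n) \<times> (real ^ 'n) \<Rightarrow> real) \<Rightarrow> bool" where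
  "network_product_sum h \<longleftrightarrow> (\<exists>r\<ge>1. \<exists>f g :: nat \<Rightarrow> real ^ 'n \<Rightarrow> real.
    (\<forall>j\<in>{1..r}. neural_network (f j) \<and> neural_network (g j)) \<and>
    h = (\<lambda>(x, y). \<Sum>j=1..r. f j x * g j y))"

lemma network_product_sum_product:
  assumes "neural_network f" "neural_network g"
  shows "network_product_sum (\<lambda>p. f (fst p) * g (snd p))"
  unfolding network_product_sum_def
  using assms by (intro exI[of _ 1] exI[of _ "\<lambda>_. f"] exI[of _ "\<lambda>_. g"] conjI)
    (auto simp: case_prod_unfold)

lemma network_product_sum_add:
  assumes "network_product_sum h" "network_product_sum h'"
  shows "network_product_sum (\<lambda>p. h p + h' p)"
proof -
  obtain r f g where 1: "r \<ge> 1" "\<forall>j\<in>{1..r::nat}. neural_network (f j) \<and> neural_network (g j)"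
    "h = (\<lambda>(x, y). \<Sum>j=1..r. f j x * g j y)"
    using assms(1) unfolding network_product_sum_def by blast
  obtain r' f' g' where 2: "r' \<ge> 1"
    "\<forall>j\<in>{1..r'::nat}. neural_network (f' j) \<and> neural_network (g' j)"
    "h' = (\<lambda>(x, y). \<Sum>j=1..r'. f' j x * g' j y)"
    using assms(2) unfolding network_product_sum_def by blast
  \<comment> \<open>The two families are concatenated; as indices start at 1, position r + i holds
    member i of the second.\<close>
  define F where "F j = (if j \<le> r then f j else f' (j - r))" for j
  define G where "G j = (if j \<le> r then g j else g' (j - r))" for j
  have "(\<Sum>j=1..r + r'. F j x * G j y) =
      (\<Sum>j=1..r. f j x * g j y) + (\<Sum>j=1..r'. f' j x * g' j y)" for x y
  proof -
    have "(\<Sum>j=1..r + r'. F j x * G j y) =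
        (\<Sum>j=1..r. F j x * G j y) + (\<Sum>j=r+1..r+r'. F j x * G j y)"
      using sum.ub_add_nat[of 1 r "\<lambda>j. F j x * G j y" r'] by simp
    also have "(\<Sum>j=r+1..r+r'. F j x * G j y) = (\<Sum>j=1..r'. F (j + r) x * G (j + r) y)"
      using sum.shift_bounds_cl_nat_ivl[of "\<lambda>j. F j x * G j y" 1 r r'] by (simp add: add.commute)
    also have "\<dots> = (\<Sum>j=1..r'. f' j x * g' j y)"
      by (intro sum.cong) (auto simp: F_def G_def)
    also have "(\<Sum>j=1..r. F j x * G j y) = (\<Sum>j=1..r. f j x * g j y)"
      by (intro sum.cong) (auto simp: F_def G_def)
    finally show ?thesis .
  qed
  then have "(\<lambda>p. h p + h' p) = (\<lambda>(x, y). \<Sum>j=1..r + r'. F j x * G j y)"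
    by (simp add: 1(3) 2(3) case_prod_unfold)
  moreover have "\<forall>j\<in>{1..r + r'}. neural_network (F j) \<and> neural_network (G j)"
    using 1(2) 2(2) by (force simp: F_def G_def intro: bspec)
  ultimately show ?thesis
    unfolding network_product_sum_def using \<open>r \<ge> 1\<close>
    by (intro exI[of _ "r + r'"] exI[of _ F] exI[of _ G] conjI) auto
qed

section \<open>Uniform approximation by sums of network products\<close>

text \<open>A monomial is a product of two exponentials, each a uniform limit of networks; a sum
  splits the error in halves, hence the induction for arbitrary \<open>e\<close>. Continuity of
  \<open>h\<close> is recorded for the later passage to the \<open>L2_norm\<close>.\<close>

lemma exp_poly_network_approx:
  fixes X Y :: "(real ^ 'n) set"
  assumes "exp_poly q" "compact X" "compact Y" "e > 0"
  shows "\<exists>h. network_product_sum h \<and> continuous_on (X \<times> Y) h \<and> (\<forall>p\<in>X \<times> Y. \<bar>q p - h p\<bar> < e)"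
  using assms(1,4)
proof (induction arbitrary: e rule: exp_poly.induct)
  case (monomial c w v)
  let ?E = "\<lambda>n w x. neural_exp (real n) (w \<bullet> x :: real)"
  \<comment> \<open>Uniform limits may be multiplied because both limit functions are
    bounded.\<close>
  have bdd: "bounded ((\<lambda>p. k * exp (z \<bullet> t p)) ` (X \<times> Y))"
    if "continuous_on (X \<times> Y) t" for z :: "real ^ 'n" and t and k :: real
    by (intro compact_imp_bounded compact_continuous_image compact_Times assms continuous_intros that)
  have "uniform_limit (X \<times> Y) (\<lambda>n p. c * ?E n w (fst p)) (\<lambda>p. c * exp (w \<bullet> fst p)) sequentially"
    by (intro bounded_linear.uniform_limit[OF bounded_linear_mult_right]
        uniform_limit_compose'[OF uniform_limit_neural_exp[of X]] compact_imp_bounded assms) auto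
  moreover have "uniform_limit (X \<times> Y) (\<lambda>n p. ?E n v (snd p)) (\<lambda>p. exp (v \<bullet> snd p)) sequentially"
    by (intro uniform_limit_compose'[OF uniform_limit_neural_exp[of Y]] compact_imp_bounded assms) auto
  ultimately have "uniform_limit (X \<times> Y) (\<lambda>n p. (c * ?E n w (fst p)) * ?E n v (snd p))
      (\<lambda>p. (c * exp (w \<bullet> fst p)) * exp (v \<bullet> snd p)) sequentially"
    by (rule uniform_lim_mult)
      (use bdd[OF continuous_on_fst[OF continuous_on_id], of c w]
        bdd[OF continuous_on_snd[OF continuous_on_id], of 1 v] in simp_all)
  then obtain n where n: "\<forall>p\<in>X \<times> Y. \<bar>(c * ?E n w (fst p)) * ?E n v (snd p)
      - (c * exp (w \<bullet> fst p)) * exp (v \<bullet> snd p)\<bar> < e"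
    using \<open>e > 0\<close> unfolding uniform_limit_iff dist_real_def eventually_sequentially by blast
  show ?case
  proof (intro exI conjI ballI)
    show "network_product_sum (\<lambda>p. (c * ?E n w (fst p)) * ?E n v (snd p))"
      using network_product_sum_product[OF neural_network_neural_exp[of c "real n" w]
          neural_network_neural_exp[of 1 "real n" v]] by simp
    show "continuous_on (X \<times> Y) (\<lambda>p. (c * ?E n w (fst p)) * ?E n v (snd p))"
      unfolding neural_exp_def by (intro continuous_intros) auto
    show "\<bar>c * (exp (w \<bullet> fst p) * exp (v \<bullet> snd p)) - (c * ?E n w (fst p)) * ?E n v (snd p)\<bar> < e"
      if "p \<in> X \<times> Y" for p
      using bspec[OF n that] by (simp only: abs_minus_commute mult.assoc)
  qed
next
  case (add f g)
  obtain h where h: "network_product_sum h" "continuous_on (X \<times> Y) h"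
    "\<forall>p\<in>X \<times> Y. \<bar>f p - h p\<bar> < e/2"
    using add.IH(1)[of "e/2"] add.prems by auto
  obtain k where k: "network_product_sum k" "continuous_on (X \<times> Y) k"
    "\<forall>p\<in>X \<times> Y. \<bar>g p - k p\<bar> < e/2"
    using add.IH(2)[of "e/2"] add.prems by auto
  show ?case
  proof (intro exI conjI ballI)
    show "network_product_sum (\<lambda>p. h p + k p)"
      using h(1) k(1) by (rule network_product_sum_add)
    show "continuous_on (X \<times> Y) (\<lambda>p. h p + k p)"
      using h(2) k(2) by (rule continuous_on_add)
    show "\<bar>f p + g p - (h p + k p)\<bar> < e" if "p \<in> X \<times> Y" for p
      using bspec[OF h(3) that] bspec[OF k(3) that] by linarith
  qed
qed

text \<open>Half of the error goes to Stone-Weierstrass, half to replacing exponentials by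
  networks.\<close>

lemma continuous_network_approx:
  fixes X Y :: "(real ^ 'n) set"
  assumes "compact X" "compact Y" "continuous_on (X \<times> Y) v" "e > 0"
  obtains h where "network_product_sum h" "continuous_on (X \<times> Y) h"
    "\<And>p. p \<in> X \<times> Y \<Longrightarrow> \<bar>v p - h p\<bar> < e"
proof -
  have "\<exists>q. exp_poly q \<and> (\<forall>p \<in> X \<times> Y. \<bar>v p - q p\<bar> < e/2)"
    by (rule Stone_Weierstrass_HOL[OF compact_Times[OF assms(1,2)]])
      (use assms in \<open>auto intro: exp_poly_const continuous_on_exp_poly exp_poly.add exp_poly_mult
        exp_poly_separates\<close>)
  then obtain q where q: "exp_poly q" "\<And>p. p \<in> X \<times> Y \<Longrightarrow> \<bar>v p - q p\<bar> < e/2"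
    by blast
  obtain h where h: "network_product_sum h" "continuous_on (X \<times> Y) h"
    "\<And>p. p \<in> X \<times> Y \<Longrightarrow> \<bar>q p - h p\<bar> < e/2"
    using exp_poly_network_approx[OF q(1) assms(1,2), of "e/2"] \<open>e > 0\<close> by auto
  have "\<bar>v p - h p\<bar> < e" if "p \<in> X \<times> Y" for p
    using q(2)[OF that] h(3)[OF that] by linarith
  with h(1,2) show thesis
    using that by blast
qed

section \<open>Combining density and uniform approximation\<close>

theorem theorem1:
  fixes X Y :: "(real ^ 'n) set"
    and u :: "(real ^ 'n) \<times> (real ^ 'n) \<Rightarrow> real"
  assumes "compact X" and "compact Y"
    and "u \<in> L2_space (X \<times> Y)"
  shows "\<forall>\<epsilon>>0. \<exists>r\<ge>1. \<exists>f g :: nat \<Rightarrow> real ^ 'n \<Rightarrow> real.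
    (\<forall>j\<in>{1..r}. neural_network (f j) \<and> neural_network (g j)) \<and>
    (\<lambda>(x, y). u (x, y) - (\<Sum>j=1..r. f j x * g j y)) \<in> L2_space (X \<times> Y) \<and>
    L2_norm (X \<times> Y) (\<lambda>(x, y). u (x, y) - (\<Sum>j=1..r. f j x * g j y)) < \<epsilon>"
proof (intro allI impI)
  fix \<epsilon> :: real assume "\<epsilon> > 0"
  have S: "compact (X \<times> Y)"
    using assms(1,2) by (rule compact_Times)
  obtain v where v: "continuous_on UNIV v" "(\<lambda>z. u z - v z) \<in> L2_space (X \<times> Y)"
    "L2_norm (X \<times> Y) (\<lambda>z. u z - v z) < \<epsilon>/2"
    using L2_continuous_approx[OF S assms(3), of "\<epsilon>/2"] \<open>\<epsilon> > 0\<close> by auto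
  have cv: "continuous_on (X \<times> Y) v"
    using v(1) continuous_on_subset by blast
  obtain d where d: "d > 0" "\<And>f. continuous_on (X \<times> Y) f \<Longrightarrow>
      (\<And>z. z \<in> X \<times> Y \<Longrightarrow> \<bar>f z\<bar> < d) \<Longrightarrow> L2_norm (X \<times> Y) f < \<epsilon>/2"
    using L2_norm_less_of_uniform[OF S, of "\<epsilon>/2"] \<open>\<epsilon> > 0\<close> by auto
  obtain h where h: "network_product_sum h" "continuous_on (X \<times> Y) h"
    "\<And>p. p \<in> X \<times> Y \<Longrightarrow> \<bar>v p - h p\<bar> < d"
    using continuous_network_approx[OF assms(1,2) cv d(1)] by blast
  have cvh: "continuous_on (X \<times> Y) (\<lambda>z. v z - h z)"
    using cv h(2) by (rule continuous_on_diff)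
  have vh: "(\<lambda>z. v z - h z) \<in> L2_space (X \<times> Y)" "L2_norm (X \<times> Y) (\<lambda>z. v z - h z) < \<epsilon>/2"
    using continuous_in_L2_space[OF S cvh] d(2)[OF cvh h(3)] by auto
  \<comment> \<open>Here u - h is split as (u - v) + (v - h).\<close>
  have uh: "(\<lambda>z. u z - h z) \<in> L2_space (X \<times> Y)" "L2_norm (X \<times> Y) (\<lambda>z. u z - h z) < \<epsilon>"
    using L2_space_add[OF v(2) vh(1)] L2_norm_add_less[OF v(2,3) vh \<open>\<epsilon> > 0\<close>] by simp_all
  obtain r f g where rfg: "r \<ge> 1" "\<forall>j\<in>{1..r::nat}. neural_network (f j) \<and> neural_network (g j)"
    "h = (\<lambda>(x, y). \<Sum>j=1..r. f j x * g j y)"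
    using h(1) unfolding network_product_sum_def by blast
  have eq: "(\<lambda>z. u z - h z) = (\<lambda>(x, y). u (x, y) - (\<Sum>j=1..r. f j x * g j y))"
    by (auto simp: rfg(3))
  show "\<exists>r\<ge>1. \<exists>f g :: nat \<Rightarrow> real ^ 'n \<Rightarrow> real.
    (\<forall>j\<in>{1..r}. neural_network (f j) \<and> neural_network (g j)) \<and>
    (\<lambda>(x, y). u (x, y) - (\<Sum>j=1..r. f j x * g j y)) \<in> L2_space (X \<times> Y) \<and>
    L2_norm (X \<times> Y) (\<lambda>(x, y). u (x, y) - (\<Sum>j=1..r. f j x * g j y)) < \<epsilon>"
    by (intro exI[of _ r] exI[of _ f] exI[of _ g] conjI rfg(1,2) uh[unfolded eq])
qed

end
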